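(* Let $f,\bar f:\mathbb V^{n_x}\to\mathbb V^{n_x}$ be the full-system uncertainty-propagation operator and the truth full-system uncertainty-propagation operator of a network, let $h:\mathbb V^{n_x}\to\mathbb V^{n_x}$ be a fixed-point operator for $f$ and $\bar h:\mathbb V^{n_x}\to\mathbb V^{n_x}$ a truth fixed-point operator for $\bar f$. Let $x_\star$ be a solution of $x_\star=f(x_\star)$ (so that $x_\star=h(x_\star)$) and let $\bar x_\star$ be a solution of $\bar x_\star=\bar f(\bar x_\star)$ (so that $\bar x_\star=\bar h(\bar x_\star)$). Assume that there is a Lipschitz constant $L_{\bar h}<1$ with $$\|\bar h(x_1)-\bar h(x_2)\|\le L_{\bar h}\|x_1-x_2\|\qquad\text{for all }x_1,x_2\in\mathbb V^{n_x}.$$ Then $$\|\bar x_\star-x_\star\|\le\frac{1}{1-L_{\bar h}}\,\|x_\star-\bar h(x_\star)\|.$$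
   Context: $\mathbb V$ is the real vector space of real-valued random variables on a fixed probability space, equipped with a norm $\|\cdot\|$ (e.g. $\|x\|=(\mathbb E|x|^p)^{1/p}$); it may be treated as an abstract real normed space. For $N\in\mathbb N$, $\mathbb V^N$ also carries a norm, denoted $\|\cdot\|$ as well (e.g. $\|x\|=(\sum_{i}\|x_i\|^q)^{1/q}$). Network: there are $n$ components; component $i$ has $n_{y,i}$ endogenous inputs and $n_{x,i}$ outputs, $n_y=\sum_i n_{y,i}$, $n_x=\sum_i n_{x,i}$. Exogenous inputs are fixed throughout and suppressed from the notation. Each component has an uncertainty-propagation operator $f_i:\mathbb V^{n_{y,i}}\to\mathbb V^{n_{x,i}}$ and a "truth" uncertainty-propagation operator $\bar f_i:\mathbb V^{n_{y,i}}\to\mathbb V^{n_{x,i}}$ (which $f_i$ approximates). $E_i^x\in\{0,1\}^{n_{x,i}\times n_x}$ and $E_i^y\in\{0,1\}^{n_{y,i}\times n_y}$ are the rows of the identity matrix extracting the block of component $i$. The adjacency matrix $A\in\{0,1\}^{n_y\times n_x}$ expresses the endogenous inputs as outputs, $y=Ax$; its diagonal blocks $E_i^yA(E_i^x)^T$ are zero. The full-system operators are $$f(x)=\sum_{i=1}^n(E_i^x)^Tf_i(E_i^yAx),\qquad \bar f(x)=\sum_{i=1}^n(E_i^x)^T\bar f_i(E_i^yAx).$$ A fixed-point operator for $f$ is any function $h:\mathbb V^{n_x}\to\mathbb V^{n_x}$ such that $x\mapsto x-h(x)$ and $x\mapsto x-f(x)$ have the same roots; a truth fixed-point operator is any function $\bar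 h:\mathbb V^{n_x}\to\mathbb V^{n_x}$ such that $x\mapsto x-\bar h(x)$ and $x\mapsto x-\bar f(x)$ have the same roots. *)

theory Defs
  imports Complex_Main "HOL-Library.FuncSet" "Jordan_Normal_Form.Matrix"
begin

text \<open>
  The space of random variables is an arbitrary real normed space \<open>'v\<close>, and \<open>'v\<^sup>N\<close> is
  \<open>carrier_vec N :: 'v vec set\<close>. Since scalars are real and entries are in \<open>'v\<close>, the products
  of the matrix library, which multiply within one semiring, do not apply.
\<close>

definition scaleR_vec :: "real \<Rightarrow> 'v::real_vector vec \<Rightarrow> 'v vec" where
  "scaleR_vec c x = map_vec (\<lambda>v. c *\<^sub>R v) x"

definition mat_app :: "real mat \<Rightarrow> 'v::real_vector vec \<Rightarrow> 'v vec" where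
  "mat_app M x = vec (dim_row M) (\<lambda>r. \<Sum>c<dim_col M. M $$ (r, c) *\<^sub>R (x $ c))"

text \<open>
  An arbitrary norm on \<open>'v\<^sup>N\<close>, not necessarily one built from the norm of \<open>'v\<close>; nonnegativity
  follows from the other axioms, as in \<open>real_normed_vector\<close>.
\<close>

definition norm_on_vec :: "nat \<Rightarrow> ('v::real_vector vec \<Rightarrow> real) \<Rightarrow> bool" where
  "norm_on_vec N nrm \<longleftrightarrow>
     (\<forall>x\<in>carrier_vec N. nrm x = 0 \<longleftrightarrow> x = 0\<^sub>v N) \<and>
     (\<forall>x\<in>carrier_vec N. \<forall>y\<in>carrier_vec N. nrm (x + y) \<le> nrm x + nrm y) \<and>
     (\<forall>c. \<forall>x\<in>carrier_vec N. nrm (scaleR_vec c x) = \<bar>c\<bar> * nrm x)"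

text \<open>
  Vectors of length \<open>d 0 + \<dots> + d (n - 1)\<close> are split into \<open>n\<close> consecutive blocks, block \<open>i < n\<close>
  having length \<open>d i\<close> (components are numbered from 0). The matrix below consists of the rows of
  the identity that extract block \<open>i\<close>.
\<close>

definition block_extract :: "nat \<Rightarrow> (nat \<Rightarrow> nat) \<Rightarrow> nat \<Rightarrow> real mat" where
  "block_extract n d i =
     mat (d i) (\<Sum>j<n. d j) (\<lambda>(r, c). 1\<^sub>m (\<Sum>j<n. d j) $$ ((\<Sum>j<i. d j) + r, c))"

locale uncertainty_network =
  fixes n :: nat
    and dy dx :: "nat \<Rightarrow> nat"
    and A :: "real mat"
    and comp comp_truth :: "nat \<Rightarrow> 'v::real_normed_vector vec \<Rightarrow> 'v vec"
  assumes comp: "i < n \<Longrightarrow> comp i \<in> carrier_vec (dy i) \<rightarrow> carrier_vec (dx i)"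
    and comp_truth: "i < n \<Longrightarrow> comp_truth i \<in> carrier_vec (dy i) \<rightarrow> carrier_vec (dx i)"
    and A_carrier: "A \<in> carrier_mat (\<Sum>i<n. dy i) (\<Sum>i<n. dx i)"
    and A_01: "elements_mat A \<subseteq> {0, 1}"
    and A_diag: "i < n \<Longrightarrow>
      block_extract n dy i * A * transpose_mat (block_extract n dx i) = 0\<^sub>m (dy i) (dx i)"

text \<open>
  \<open>x \<mapsto> \<Sum>i<n. (E\<^sub>i\<^sup>x)\<^sup>T g\<^sub>i (E\<^sub>i\<^sup>y A x)\<close> for a family \<open>g\<close> of component operators.
\<close>

definition full_system ::
    "nat \<Rightarrow> (nat \<Rightarrow> nat) \<Rightarrow> (nat \<Rightarrow> nat) \<Rightarrow> real mat \<Rightarrow>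
     (nat \<Rightarrow> 'v::real_normed_vector vec \<Rightarrow> 'v vec) \<Rightarrow> 'v vec \<Rightarrow> 'v vec" where
  "full_system n dy dx A g x =
     finsum_vec TYPE('v) (\<Sum>i<n. dx i)
       (\<lambda>i. mat_app (transpose_mat (block_extract n dx i))
              (g i (mat_app (block_extract n dy i) (mat_app A x))))
       {..<n}"

definition fixed_point_operator ::
    "nat \<Rightarrow> ('v::real_normed_vector vec \<Rightarrow> 'v vec) \<Rightarrow> ('v vec \<Rightarrow> 'v vec) \<Rightarrow> bool" where
  "fixed_point_operator N f h \<longleftrightarrow>
     h \<in> carrier_vec N \<rightarrow> carrier_vec N \<and>
     {x \<in> carrier_vec N. x - h x = 0\<^sub>v N} = {x \<in> carrier_vec N. x - f x = 0\<^sub>v N}"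

end

theory Submission
  imports Defs
begin

text \<open>
  The argument is the a posteriori estimate of the contraction principle, with the fixed point
  given instead of constructed. Agreement of the root sets makes the solution of the truth system
  a fixed point \<open>p\<close> of the truth fixed-point operator \<open>g\<close>
  (\<open>fixed_point_operator_fixes\<close>). For a vector \<open>x\<close> one then splits
  \<open>p - x = (g p - g x) + (g x - x)\<close>: the first summand has norm at most
  \<open>L * \<parallel>p - x\<parallel>\<close>, and the second is the residual of \<open>x\<close> up to sign. Moving the first term to the
  left and dividing by \<open>1 - L > 0\<close> gives the bound (\<open>residual_bounds_distance_to_fixed_point\<close>).
\<close>

lemma norm_on_vec_minus_commute:
  fixes nrm :: "'v::real_normed_vector vec \<Rightarrow> real"
  assumes "norm_on_vec N nrm" and x: "x \<in> carrier_vec N" and y: "y \<in> carrier_vec N"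
  shows "nrm (x - y) = nrm (y - x)"
proof -
  have "scaleR_vec (-1) (y - x) = x - y"
    using x y by (intro eq_vecI) (auto simp: scaleR_vec_def)
  moreover have "nrm (scaleR_vec (-1) (y - x)) = \<bar>-1\<bar> * nrm (y - x)"
    using assms unfolding norm_on_vec_def by (meson minus_carrier_vec)
  ultimately show ?thesis by simp
qed

lemma fixed_point_operator_fixes:
  fixes h :: "'v::real_normed_vector vec \<Rightarrow> 'v vec"
  assumes "fixed_point_operator N f h" and x: "x \<in> carrier_vec N" and "x = f x"
  shows "h x = x"
proof -
  have hx: "h x \<in> carrier_vec N"
    using assms unfolding fixed_point_operator_def by auto
  have "x - f x = 0\<^sub>v N"
    using x \<open>x = f x\<close>[symmetric] by (auto intro!: eq_vecI)
  then have root: "x - h x = 0\<^sub>v N"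
    using assms unfolding fixed_point_operator_def by blast
  show ?thesis
  proof (rule eq_vecI)
    fix i assume "i < dim_vec x"
    then have i: "i < N" using x by simp
    then have "x $ i - h x $ i = (x - h x) $ i" using hx by simp
    also have "\<dots> = 0" using root i by simp
    finally show "h x $ i = x $ i" by simp
  qed (use x hx in auto)
qed

lemma residual_bounds_distance_to_fixed_point:
  fixes nrm :: "'v::real_normed_vector vec \<Rightarrow> real"
  assumes norm: "norm_on_vec N nrm"
    and g: "g \<in> carrier_vec N \<rightarrow> carrier_vec N"
    and p: "p \<in> carrier_vec N" "g p = p"
    and x: "x \<in> carrier_vec N"
    and lipschitz: "nrm (g p - g x) \<le> L * nrm (p - x)"
    and "L < 1"
  shows "nrm (p - x) \<le> 1 / (1 - L) * nrm (x - g x)"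
proof -
  have gx: "g x \<in> carrier_vec N" using g x by auto
  have "p - x = (g p - g x) + (g x - x)"
    using p x gx by (intro eq_vecI) auto
  also have "nrm \<dots> \<le> nrm (g p - g x) + nrm (g x - x)"
    using norm p x gx unfolding norm_on_vec_def by (metis minus_carrier_vec)
  also have "\<dots> \<le> L * nrm (p - x) + nrm (x - g x)"
    using lipschitz norm_on_vec_minus_commute[OF norm x gx] by simp
  finally show ?thesis
    using \<open>L < 1\<close> by (simp add: field_simps)
qed

theorem proposition5p3:
  fixes n :: nat
    and dy dx :: "nat \<Rightarrow> nat"
    and A :: "real mat"
    and comp comp_truth :: "nat \<Rightarrow> 'v::real_normed_vector vec \<Rightarrow> 'v vec"
    and N :: nat
    and nrm :: "'v vec \<Rightarrow> real"
    and f f_truth h h_truth :: "'v vec \<Rightarrow> 'v vec"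
    and x x_truth :: "'v vec"
    and L :: real
  assumes "uncertainty_network n dy dx A comp comp_truth"
    and "N = (\<Sum>i<n. dx i)"
    and "norm_on_vec N nrm"
    and "f = full_system n dy dx A comp"
    and "f_truth = full_system n dy dx A comp_truth"
    and "fixed_point_operator N f h"
    and "fixed_point_operator N f_truth h_truth"
    and "x \<in> carrier_vec N" and "x = f x"
    and "x_truth \<in> carrier_vec N" and "x_truth = f_truth x_truth"
    and "L < 1"
    and "\<forall>x1\<in>carrier_vec N. \<forall>x2\<in>carrier_vec N.
           nrm (h_truth x1 - h_truth x2) \<le> L * nrm (x1 - x2)"
  shows "nrm (x_truth - x) \<le> 1 / (1 - L) * nrm (x - h_truth x)"
proof (rule residual_bounds_distance_to_fixed_point)
  show "h_truth \<in> carrier_vec N \<rightarrow> carrier_vec N"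
    using assms(7) unfolding fixed_point_operator_def by simp
  show "h_truth x_truth = x_truth"
    using assms(7,10,11) by (rule fixed_point_operator_fixes)
qed (use assms(3,8,10,12,13) in auto)

end
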